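(* For integers $1\leq k\leq r$, let $C_r(k)$ denote the non-zero real constant such that $\zeta_r(s)\sim C_r(k)(ks-1)^{-[r/k]}$ as $s\to 1/k$, i.e. $C_r(k)=\lim_{s\to 1/k}(ks-1)^{[r/k]}\zeta_r(s)$. Then: (a) $C_r(r)=(-1)^{r-1}\frac{1}{r}$ for all $r\geq 1$; (b) $C_r(k)=\frac{(-1)^{k-1}}{k}\,\zeta_{r-k}\!\left(\frac{1}{k}\right)$ whenever $r/2<k\leq r-1$; (c) $C_r(1)=\frac{1}{r!}$ for all $r\geq 1$; (d) for every integer $k\geq 2$ and every $r\geq 1$, $$C_{kr}(k)=\frac{(-1)^{(k-1)r}}{k^r\cdot r!},\qquad C_{kr+\ell}(k)=\frac{(-1)^{(k-1)r}}{k^r\cdot r!}\,\zeta_{\ell}\!\left(\frac{1}{k}\right)\quad (1\leq \ell\leq k-1).$$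
   Context: For an integer $r\geq 1$ and $s\in\mathbb{C}$, $\zeta_r(s)=\zeta_r(s,s,\ldots,s)=\sum_{1\leq m_1<m_2<\cdots<m_r}(m_1m_2\cdots m_r)^{-s}$ is the Euler–Zagier $r$-fold zeta-function with all arguments equal; the series converges absolutely for $\Re s>1$, and $\zeta_r(s)$ is understood via its meromorphic continuation to $\mathbb{C}$, whose poles are exactly at $s=1/k$ ($1\leq k\leq r$) of order $[r/k]$ ($[x]$ the integer part of $x$). Here $\zeta_1=\zeta$ is the Riemann zeta-function, and $\zeta_0=1$. *)

theory Defs
  imports "HOL-Complex_Analysis.Complex_Analysis"
begin

(* A list [m_1, ..., m_r] stands for the index tuple 1 <= m_1 < ... < m_r. *)
definition zeta_indices :: "nat \<Rightarrow> nat list set" where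
  "zeta_indices r = {ms. length ms = r \<and> sorted_wrt (<) ms \<and> (\<forall>m\<in>set ms. 1 \<le> m)}"

(* Only meaningful for Re s > 1, where the family is absolutely summable; for r = 0 the
   only index is the empty list, so the value is 1. *)
definition multi_zeta_series :: "nat \<Rightarrow> complex \<Rightarrow> complex" where
  "multi_zeta_series r s = (\<Sum>\<^sub>\<infinity>ms\<in>zeta_indices r. of_nat (prod_list ms) powr (- s))"

(* The meromorphic continuation to the whole plane. "Nicely" pins down the values: analytic
   away from the poles (no removable singularities) and, by convention, 0 at the poles; so
   at most one function has this property. *)
definition multi_zeta :: "nat \<Rightarrow> complex \<Rightarrow> complex" where
  "multi_zeta r = (THE f. f nicely_meromorphic_on UNIV \<and>
                          (\<forall>s. Re s > 1 \<longrightarrow> f s = multi_zeta_series r s))"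

definition is_leading_const :: "nat \<Rightarrow> nat \<Rightarrow> real \<Rightarrow> bool" where
  "is_leading_const r k c \<longleftrightarrow> c \<noteq> 0 \<and>
     ((\<lambda>s. (of_nat k * s - 1) ^ (r div k) * multi_zeta r s) \<longlongrightarrow> complex_of_real c)
       (at (1 / of_nat k))"

definition leading_const :: "nat \<Rightarrow> nat \<Rightarrow> real" where
  "leading_const r k = (THE c. is_leading_const r k c)"

end

theory Submission
  imports Defs
begin

text \<open>
  For Re s > 1 the multiple zeta value with r equal arguments s is the r-th elementary symmetric
  function of the numbers n to the power -s, whose j-th power sum is the Riemann zeta function
  at j s. Newton's identities express it as a polynomial in the functions zeta (j s), which gives
  the continuation. Near s = 1/k only zeta (k s) has a pole, so in Newton's identity for r, after
  multiplication by (k s - 1) to the power r div k, only the summand j = k and the summands with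
  j at most r mod k survive; induction on r gives the limit. It is non-zero because zeta is negative
  on (0, 1), which makes all terms of Newton's identity at 1/k have the same sign.
\<close>

section \<open>Continuation of the Riemann zeta function\<close>

text \<open>The alternating series serves three purposes at once: it yields meromorphy of zeta on
  the whole plane, the residue at 1, and the sign on (0, 1), where the series is positive and
  \<open>1 - 2 powr (1 - s)\<close> is negative. The sign is essential, since it shows that zeta_l
  does not vanish at 1/k for l < k. At 1/k the obstacle is that several products in Newton's
  identity are singular together. By induction the summand j has pole order (r - j) div k, plus one
  if j = k, and comparing this with r div k selects the survivors. Write r = k q + l. The summands
  with j \<le> l recombine, by Newton's identity for l, to l times the claimed limit; the summand j
  = k gives k q times it. The total k q + l cancels the factor r in Newton's identity.\<close>

text \<open>
  Repeatedly averaging the alternating series with its shift replaces its terms by their m-th differences, which decay faster by a factor of n to the power -m.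
\<close>
fun zeta_diff :: "nat \<Rightarrow> complex \<Rightarrow> complex \<Rightarrow> complex" where
  "zeta_diff 0 s z = z powr (- s)"
| "zeta_diff (Suc m) s z = zeta_diff m s z - zeta_diff m s (z + 1)"

text \<open>Differentiation in \<open>z\<close> commutes with taking differences, so the derivative
  is again an \<open>m\<close>-th difference, for the exponent parameter \<open>s + 1\<close>. This
  feeds an induction over all \<open>s\<close> in the next bound.\<close>

lemma zeta_diff_deriv:
  "Re z > 0 \<Longrightarrow> (zeta_diff m s has_field_derivative - s * zeta_diff m (s + 1) z) (at z)"
proof (induction m arbitrary: z)
  case 0
  hence nonneg: "z \<notin> \<real>\<^sub>\<le>\<^sub>0" by (auto simp: complex_nonpos_Reals_iff)
  have "((\<lambda>w. w powr (- s)) has_field_derivative - s * z powr (- s - 1)) (at z)"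
    by (rule has_field_derivative_powr[OF nonneg])
  moreover have "- s - 1 = - (s + 1)" by simp
  ultimately show ?case by (simp only: zeta_diff.simps)
next
  case (Suc m)
  have 1: "(zeta_diff m s has_field_derivative - s * zeta_diff m (s + 1) z) (at z)"
    using Suc by simp
  have "(zeta_diff m s has_field_derivative - s * zeta_diff m (s + 1) (z + 1)) (at (z + 1))"
    using Suc by simp
  hence 2: "((\<lambda>w. zeta_diff m s (w + 1)) has_field_derivative - s * zeta_diff m (s + 1) (z + 1)) (at z)"
    by (simp only: DERIV_shift)
  show ?case using DERIV_diff[OF 1 2] by (simp add: algebra_simps)
qed

text \<open>By the mean value inequality on the segment from \<open>x\<close> to
  \<open>x + 1\<close>, each difference is bounded by a derivative, which costs a factor
  \<open>norm s\<close> and moves \<open>s\<close> to \<open>s + 1\<close>; these factors multiply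
  up to \<open>pochhammer s m\<close>. Since \<open>Re s + m \<ge> 0\<close>, the power is largest
  at the left end \<open>x\<close>.\<close>

lemma norm_zeta_diff_le:
  fixes x :: real
  assumes "x > 0" "Re s + m \<ge> 0"
  shows "norm (zeta_diff m s (of_real x)) \<le> norm (pochhammer s m) * x powr (- (Re s + m))"
  using assms
proof (induction m arbitrary: s x)
  case 0
  thus ?case by (simp add: norm_powr_real_powr)
next
  case (Suc m)
  define B where "B = norm s * (norm (pochhammer (s + 1) m) * x powr (- (Re s + Suc m)))"
  have "norm (zeta_diff m s (of_real x) - zeta_diff m s (of_real (x + 1)))
      \<le> B * norm (of_real x - of_real (x + 1) :: complex)"
  proof (rule field_differentiable_bound[where S = "of_real ` {x..x+1}"])
    show "convex (of_real ` {x..x+1} :: complex set)"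
      by (intro convex_linear_image bounded_linear.linear[OF bounded_linear_of_real]) simp
    show "of_real (x + 1) \<in> (of_real ` {x..x+1} :: complex set)" by (rule imageI) simp
    fix z :: complex assume "z \<in> of_real ` {x..x+1}"
    then obtain y where y: "z = of_real y" "x \<le> y" by auto
    show "(zeta_diff m s has_field_derivative - s * zeta_diff m (s + 1) z) (at z within of_real ` {x..x+1})"
      by (rule has_field_derivative_at_within[OF zeta_diff_deriv]) (use y Suc.prems in simp)
    have "norm (zeta_diff m (s + 1) z) \<le> norm (pochhammer (s + 1) m) * y powr (- (Re (s+1) + m))"
      unfolding y(1) using Suc.prems y(2) by (intro Suc.IH) auto
    also have "\<dots> \<le> norm (pochhammer (s + 1) m) * x powr (- (Re s + Suc m))"
    proof (rule mult_left_mono)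
      have "y powr (- (Re s + Suc m)) \<le> x powr (- (Re s + Suc m))"
        using Suc.prems y(2) by (intro powr_mono2') auto
      thus "y powr (- (Re (s+1) + m)) \<le> x powr (- (Re s + Suc m))" by (simp add: algebra_simps)
    qed auto
    finally show "norm (- s * zeta_diff m (s + 1) z) \<le> B"
      unfolding B_def by (simp only: norm_mult norm_minus_cancel) (rule mult_left_mono, auto)
  qed auto
  thus ?case
    by (simp only: B_def pochhammer_rec norm_mult mult.assoc zeta_diff.simps of_real_add of_real_1) simp
qed

lemma zeta_diff_holomorphic: "Re z > 0 \<Longrightarrow> (\<lambda>s. zeta_diff m s z) holomorphic_on A"
proof (induction m arbitrary: z)
  case 0
  hence "z \<noteq> 0" by auto
  have "(\<lambda>s. exp (- s * ln z)) holomorphic_on A" by (intro holomorphic_intros)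
  thus ?case using \<open>z \<noteq> 0\<close> by (simp add: powr_def)
next
  case (Suc m)
  hence "0 < Re (z + 1)" by simp
  from holomorphic_on_diff[OF Suc.IH[OF Suc.prems] Suc.IH[OF this]] show ?case by simp
qed

section \<open>Continuation of the Dirichlet eta function by Euler's series transformation\<close>

definition eta_series :: "nat \<Rightarrow> complex \<Rightarrow> complex" where
  "eta_series m s = (\<Sum>n. (-1) ^ n * zeta_diff m s (of_nat n + 1))"

lemma summable_Suc_powr: "a > 1 \<Longrightarrow> summable (\<lambda>n. real (Suc n) powr (- a))"
  by (subst summable_Suc_iff) (simp add: summable_real_powr_iff)

lemma norm_zeta_diff_nat_le:
  assumes "Re s + m \<ge> 0"
  shows "norm ((-1) ^ n * zeta_diff m s (of_nat n + 1)) \<le>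
    norm (pochhammer s m) * real (Suc n) powr (- (Re s + m))"
  using norm_zeta_diff_le[of "real (Suc n)" s m] assms
  by (simp add: norm_mult norm_power add.commute)

lemma summable_eta_series:
  assumes "Re s > 1 - real m"
  shows "summable (\<lambda>n. (-1) ^ n * zeta_diff m s (of_nat n + 1))"
proof (rule summable_comparison_test')
  show "summable (\<lambda>n. norm (pochhammer s m) * real (Suc n) powr (- (Re s + m)))"
    using assms by (intro summable_mult summable_Suc_powr) auto
qed (use norm_zeta_diff_nat_le[of s m] assms in auto)

lemma eta_series_holomorphic: "eta_series m holomorphic_on {s. Re s > 1 - real m}"
proof (rule holomorphic_uniform_sequence)
  show "open {s. Re s > 1 - real m}" by (rule open_halfspace_Re_gt)
  show "(\<lambda>s. \<Sum>n<N. (-1) ^ n * zeta_diff m s (of_nat n + 1)) holomorphic_on {s. Re s > 1 - real m}" for N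
    by (intro holomorphic_intros zeta_diff_holomorphic) auto
  fix s0 assume s0: "s0 \<in> {s. Re s > 1 - real m}"
  \<comment> \<open>Half the distance from \<open>s0\<close> to the boundary line: on the closed
    ball \<open>Re s + m \<ge> 1 + d\<close>, so one summable majorant serves the whole
    ball.\<close>
  define d where "d = (Re s0 - 1 + m) / 2"
  have d: "d > 0" "Re s0 = 1 - real m + 2 * d" using s0 by (auto simp: d_def field_simps)
  have Re_ge: "Re s \<ge> 1 - real m + d" if "s \<in> cball s0 d" for s
    using that abs_Re_le_cmod[of "s0 - s"] d by (auto simp: dist_norm)
  have "bounded ((\<lambda>s. pochhammer s m) ` cball s0 d)"
    unfolding pochhammer_prod
    by (intro compact_imp_bounded compact_continuous_image continuous_intros) auto
  then obtain K where "\<forall>z\<in>(\<lambda>s. pochhammer s m) ` cball s0 d. norm z \<le> K"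
    unfolding bounded_iff by blast
  hence K: "norm (pochhammer s m) \<le> K" if "s \<in> cball s0 d" for s
    using that by blast
  have K0: "K \<ge> 0" using order_trans[OF norm_ge_zero K[of s0]] d by simp
  have "uniform_limit (cball s0 d) (\<lambda>N s. \<Sum>n<N. (-1) ^ n * zeta_diff m s (of_nat n + 1))
     (\<lambda>s. \<Sum>n. (-1) ^ n * zeta_diff m s (of_nat n + 1)) sequentially"
  proof (rule Weierstrass_m_test)
    show "summable (\<lambda>n. K * real (Suc n) powr (- (1 + d)))"
      using d by (intro summable_mult summable_Suc_powr) auto
    fix n s assume s: "s \<in> cball s0 d"
    have "norm ((-1) ^ n * zeta_diff m s (of_nat n + 1)) \<le>
       norm (pochhammer s m) * real (Suc n) powr (- (Re s + m))"
      using Re_ge[OF s] d by (intro norm_zeta_diff_nat_le) auto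
    also have "\<dots> \<le> K * real (Suc n) powr (- (1 + d))"
      using Re_ge[OF s] K[OF s] K0 by (intro mult_mono powr_mono) auto
    finally show "norm ((-1) ^ n * zeta_diff m s (of_nat n + 1)) \<le> K * real (Suc n) powr (- (1 + d))" .
  qed
  moreover have "cball s0 d \<subseteq> {s. Re s > 1 - real m}" using Re_ge d by force
  ultimately show "\<exists>d>0. cball s0 d \<subseteq> {s. Re s > 1 - real m} \<and> uniform_limit (cball s0 d)
     (\<lambda>N s. \<Sum>n<N. (-1) ^ n * zeta_diff m s (of_nat n + 1)) (eta_series m) sequentially"
    using d unfolding eta_series_def by blast
qed

text \<open>A term of the series for \<open>Suc m\<close> is the sum of two consecutive terms of the
  series for \<open>m\<close>, so summing counts every term twice except the one with index
  0.\<close>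

lemma eta_series_Suc:
  assumes "Re s > 1 - real m"
  shows "eta_series (Suc m) s = 2 * eta_series m s - zeta_diff m s 1"
proof -
  define f where "f = (\<lambda>n. (-1) ^ n * zeta_diff m s (of_nat n + 1))"
  have f: "f sums eta_series m s"
    using summable_eta_series[OF assms] by (simp add: f_def eta_series_def summable_sums)
  have f2: "(\<lambda>n. f (Suc n)) sums (eta_series m s - f 0)"
    using f by (subst sums_Suc_iff) simp
  have "(\<lambda>n. f n + f (Suc n)) sums (eta_series m s + (eta_series m s - f 0))"
    by (rule sums_add[OF f f2])
  hence "(\<lambda>n. (-1) ^ n * zeta_diff (Suc m) s (of_nat n + 1)) sums (2 * eta_series m s - f 0)"
    by (simp add: f_def algebra_simps)
  thus ?thesis by (simp add: eta_series_def f_def sums_iff)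
qed

text \<open>The recursion for \<open>eta_series\<close> unrolled \<open>m\<close> times and solved
  for \<open>eta_series 0\<close>: every averaging halves the series and leaves a boundary term at
  1.\<close>

definition eta_ext :: "nat \<Rightarrow> complex \<Rightarrow> complex" where
  "eta_ext m s = eta_series m s / 2 ^ m + (\<Sum>i<m. zeta_diff i s 1 / 2 ^ Suc i)"

lemma eta_ext_Suc: "Re s > 1 - real m \<Longrightarrow> eta_ext (Suc m) s = eta_ext m s"
  by (simp add: eta_ext_def eta_series_Suc field_simps)

lemma eta_ext_add: "Re s > 1 - real m \<Longrightarrow> eta_ext (m + n) s = eta_ext m s"
  by (induction n) (auto simp: eta_ext_Suc)

text \<open>The number of averagings depends on \<open>s\<close> and is just large enough for
  \<open>Re s > 1 - m\<close>; any other admissible number gives the same value.\<close>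

definition eta :: "complex \<Rightarrow> complex" where
  "eta s = eta_ext (nat \<lceil>2 - Re s\<rceil>) s"

lemma eta_eq:
  assumes "Re s > 1 - real m"
  shows "eta s = eta_ext m s"
proof -
  define k where "k = nat \<lceil>2 - Re s\<rceil>"
  have k: "Re s > 1 - real k" unfolding k_def by linarith
  have "eta s = eta_ext (k + m) s" by (simp only: eta_ext_add[OF k]) (simp add: eta_def k_def)
  also have "\<dots> = eta_ext m s" using eta_ext_add[OF assms, of k] by (simp add: add.commute)
  finally show ?thesis .
qed

lemma eta_ext_holomorphic: "eta_ext m holomorphic_on {s. Re s > 1 - real m}"
  unfolding eta_ext_def
  by (intro holomorphic_intros eta_series_holomorphic zeta_diff_holomorphic) auto

lemma eta_analytic [analytic_intros]: "eta analytic_on A"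
proof -
  have "eta analytic_on {s}" for s
  proof -
    define m where "m = nat \<lceil>2 - Re s\<rceil>"
    have "eta holomorphic_on {s. Re s > 1 - real m}"
      using eta_ext_holomorphic[of m] by (rule holomorphic_transform) (auto simp: eta_eq)
    hence "eta analytic_on {s. Re s > 1 - real m}"
      by (simp add: analytic_on_open open_halfspace_Re_gt)
    moreover have "Re s > 1 - real m" unfolding m_def by linarith
    ultimately show ?thesis by (auto intro: analytic_on_subset)
  qed
  thus ?thesis using analytic_on_analytic_at by blast
qed

section \<open>The eta function on the positive real axis\<close>

lemma sums_even: "(\<lambda>n. (1 + (-1) ^ n) * f n) sums c \<longleftrightarrow> (\<lambda>k. 2 * f (2 * k)) sums c"
  for f :: "nat \<Rightarrow> 'a :: real_normed_field"
proof -
  have "(\<lambda>k. (1 + (-1) ^ (2 * k)) * f (2 * k)) sums c \<longleftrightarrow> (\<lambda>n. (1 + (-1) ^ n) * f n) sums c"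
  proof (rule sums_mono_reindex)
    show "(1 + (-1) ^ n) * f n = 0" if "n \<notin> range (\<lambda>k. 2 * k)" for n
      using that by (cases "even n") auto
  qed (auto simp: strict_mono_def)
  thus ?thesis by simp
qed

lemma sums_odd: "(\<lambda>n. (1 - (-1) ^ n) * f n) sums c \<longleftrightarrow> (\<lambda>k. 2 * f (2 * k + 1)) sums c"
  for f :: "nat \<Rightarrow> 'a :: real_normed_field"
proof -
  have "(\<lambda>k. (1 - (-1) ^ (2 * k + 1)) * f (2 * k + 1)) sums c \<longleftrightarrow> (\<lambda>n. (1 - (-1) ^ n) * f n) sums c"
  proof (rule sums_mono_reindex)
    show "(1 - (-1) ^ n) * f n = 0" if "n \<notin> range (\<lambda>k. 2 * k + 1)" for n
    proof (cases "even n")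
      case False
      then obtain k where "n = 2 * k + 1" by (elim oddE)
      with that show ?thesis by auto
    qed auto
  qed (auto simp: strict_mono_def)
  thus ?thesis by simp
qed

text \<open>One averaging suffices for \<open>x > 0\<close>: \<open>eta x\<close> is half of
  \<open>1 + eta_series 1 x\<close>. The 1 is the telescoping sum of the differences
  \<open>a n\<close>; added to their alternating sum, it leaves twice the differences of even
  index.\<close>

lemma eta_real_sums:
  fixes x :: real
  assumes "x > 0"
  shows "(\<lambda>k. (2 * real k + 1) powr (- x) - (2 * real k + 2) powr (- x)) sums Re (eta x)"
    and "eta x \<in> \<real>"
proof -
  define a where "a = (\<lambda>n::nat. (real n + 1) powr (- x) - (real n + 2) powr (- x))"
  have zd: "zeta_diff 1 x (of_nat n + 1) = of_real (a n)" for n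
  proof -
    have "(of_nat n + 1 :: complex) powr (- of_real x) = of_real ((real n + 1) powr (- x))"
      using powr_of_real[of "real n + 1" "- x"] by simp
    moreover have "(of_nat n + 2 :: complex) powr (- of_real x) = of_real ((real n + 2) powr (- x))"
      using powr_of_real[of "real n + 2" "- x"] by simp
    ultimately show ?thesis by (simp add: a_def add.assoc)
  qed
  have "(\<lambda>n. real (Suc n) powr (- x)) \<longlonglongrightarrow> 0"
    using assms by (intro tendsto_neg_powr filterlim_compose[OF filterlim_real_sequentially filterlim_Suc]) auto
  hence "(\<lambda>n. real (Suc n) powr (- x) - real (Suc (Suc n)) powr (- x)) sums (real (Suc 0) powr (- x) - 0)"
    by (intro telescope_sums')
  hence tele: "(\<lambda>n. of_real (a n) :: complex) sums of_real 1"
    by (intro sums_of_real) (simp add: a_def add_ac)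
  have "(\<lambda>n. (-1) ^ n * zeta_diff 1 x (of_nat n + 1)) sums eta_series 1 x"
    unfolding eta_series_def by (intro summable_sums summable_eta_series) (use assms in auto)
  hence "(\<lambda>n. (-1) ^ n * of_real (a n)) sums eta_series 1 x"
    by (simp only: zd)
  from sums_add[OF tele this] have "(\<lambda>n. (1 + (-1) ^ n) * of_real (a n)) sums (1 + eta_series 1 x)"
    by (simp add: algebra_simps)
  hence "(\<lambda>k. 2 * of_real (a (2 * k))) sums (1 + eta_series 1 x)"
    by (simp only: sums_even)
  hence "(\<lambda>k. 2 * of_real (a (2 * k)) / 2) sums ((1 + eta_series 1 x) / 2)"
    by (rule sums_divide)
  hence "(\<lambda>k. of_real (a (2 * k))) sums ((1 + eta_series 1 x) / 2)"
    by simp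
  moreover have "eta x = eta_ext 1 x" using assms by (intro eta_eq) auto
  hence "eta x = (1 + eta_series 1 x) / 2"
    by (simp add: eta_ext_def field_simps)
  ultimately have *: "(\<lambda>k. of_real (a (2 * k))) sums eta x" by (simp only:)
  from sums_Re[OF this] show "(\<lambda>k. (2 * real k + 1) powr (- x) - (2 * real k + 2) powr (- x)) sums Re (eta x)"
    by (simp add: a_def)
  from sums_Im[OF *] have "Im (eta x) = 0" by (simp add: sums_iff)
  thus "eta x \<in> \<real>" by (simp add: complex_is_Real_iff)
qed

lemma eta_real_pos:
  fixes x :: real assumes "x > 0" shows "Re (eta x) > 0"
proof -
  note s = eta_real_sums(1)[OF assms]
  have "(2 * real k + 1) powr (- x) - (2 * real k + 2) powr (- x) > 0" for k
    using assms by (simp add: powr_less_mono2_neg)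
  with suminf_pos[OF sums_summable[OF s]] sums_unique[OF s] show ?thesis by simp
qed

lemma eta_1: "eta 1 = of_real (ln 2)"
proof -
  have "(\<lambda>k. (2 * real k + 1) powr (- 1) - (2 * real k + 2) powr (- 1)) sums Re (eta (of_real 1))"
    by (rule eta_real_sums) auto
  hence "(\<lambda>k. inverse (real (2*k+1)) - inverse (real (2*k+2))) sums Re (eta 1)"
    by (simp add: powr_minus add_ac)
  hence "Re (eta 1) = ln 2" using alternating_harmonic_series_sums' sums_unique2 by blast
  moreover have "eta 1 \<in> \<real>" using eta_real_sums(2)[of 1] by simp
  ultimately show ?thesis by (metis of_real_Re)
qed

text \<open>
  At all zeros of the denominator the value is the junk value 0;
  apart from the residue at 1, only meromorphy matters there, so the vanishing of eta at the other
  zeros need not be shown.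
\<close>
definition zeta :: "complex \<Rightarrow> complex" where
  "zeta s = eta s / (1 - 2 powr (1 - s))"

section \<open>Analyticity, Dirichlet series, residue and sign of zeta\<close>

lemma two_powr_eq_1D:
  assumes "(2 :: complex) powr (1 - s) = 1" shows "Re s = 1"
proof -
  have "norm ((2 :: complex) powr (1 - s)) = 2 powr (1 - Re s)"
    using norm_powr_real_powr[of 2 "1 - s"] by simp
  thus ?thesis using assms by simp
qed

lemma zeta_meromorphic [meromorphic_intros]: "zeta meromorphic_on A"
  unfolding zeta_def
  by (intro meromorphic_intros analytic_on_imp_meromorphic_on analytic_intros) auto

lemma zeta_analytic: "Re s \<noteq> 1 \<Longrightarrow> zeta analytic_on {s}"
  unfolding zeta_def using two_powr_eq_1D[of s]
  by (intro analytic_intros) auto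

text \<open>Subtracting the alternating sum from the full sum \<open>Z\<close> leaves twice the
  terms of the even integers, that is \<open>2 powr (1 - s) * Z\<close>. The resulting equation is
  solved for \<open>Z\<close>.\<close>

lemma zeta_sums:
  assumes "Re s > 1"
  shows "(\<lambda>n. of_nat (Suc n) powr (- s)) sums zeta s"
proof -
  define a where "a = (\<lambda>n. of_nat (Suc n) powr (- s))"
  have "summable (\<lambda>n. norm (a n))"
    using summable_Suc_powr[OF assms] by (simp add: a_def norm_powr_real_powr del: of_nat_Suc)
  then obtain Z where Z: "a sums Z" by (blast dest: summable_norm_cancel summable_sums)
  have "(\<lambda>n. (-1) ^ n * zeta_diff 0 s (of_nat n + 1)) sums eta_series 0 s"
    unfolding eta_series_def by (intro summable_sums summable_eta_series) (use assms in auto)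
  moreover have "eta s = eta_series 0 s" using assms by (subst eta_eq[of 0]) (auto simp: eta_ext_def)
  ultimately have E: "(\<lambda>n. (-1) ^ n * a n) sums eta s" by (simp add: a_def add_ac)
  from sums_diff[OF Z E] have "(\<lambda>n. (1 - (-1) ^ n) * a n) sums (Z - eta s)"
    by (simp add: algebra_simps)
  hence "(\<lambda>k. 2 * a (2 * k + 1)) sums (Z - eta s)" by (simp only: sums_odd)
  \<comment> \<open>Index \<open>2 * k + 1\<close> stands for the integer \<open>2 * k + 2\<close>,
    the double of the integer \<open>k + 1\<close> at index \<open>k\<close>.\<close>
  moreover have "2 * a (2 * k + 1) = 2 powr (1 - s) * a k" for k
  proof -
    have "of_nat (Suc (2 * k + 1)) = of_real 2 * (of_real (real (Suc k)) :: complex)"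
      by (simp add: algebra_simps)
    hence "a (2 * k + 1) = of_real 2 powr (- s) * of_real (real (Suc k)) powr (- s)"
      unfolding a_def by (simp only:) (rule powr_times_real, auto)
    moreover have "(2::complex) powr (1 - s) = 2 * 2 powr (- s)"
      by (simp add: powr_diff powr_minus field_simps)
    ultimately show ?thesis by (simp add: a_def)
  qed
  ultimately have "(\<lambda>k. 2 powr (1 - s) * a k) sums (Z - eta s)" by simp
  with sums_mult[OF Z] have "2 powr (1 - s) * Z = Z - eta s" using sums_unique2 by blast
  moreover have "(2::complex) powr (1 - s) \<noteq> 1" using two_powr_eq_1D assms by force
  ultimately have "Z = zeta s" unfolding zeta_def by (simp add: field_simps)
  with Z show ?thesis by (simp add: a_def)
qed

text \<open>The denominator of \<open>zeta\<close> vanishes at 1 with derivative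
  \<open>ln 2\<close>, which is also the value of \<open>eta\<close> there.\<close>

lemma zeta_residue: "((\<lambda>s. (s - 1) * zeta s) \<longlongrightarrow> 1) (at 1)"
proof -
  have "((\<lambda>s::complex. 1 - 2 powr (1 - s)) has_field_derivative ln 2) (at 1)"
    unfolding powr_def by (auto intro!: derivative_eq_intros)
  hence "((\<lambda>s::complex. (1 - 2 powr (1 - s)) / (s - 1)) \<longlongrightarrow> of_real (ln 2)) (at 1)"
    by (simp add: has_field_derivative_iff Ln_of_real[symmetric])
  moreover have "(eta \<longlongrightarrow> of_real (ln 2)) (at 1)"
    using eta_1 analytic_at_imp_isCont[OF eta_analytic, of 1] by (simp add: isCont_def)
  ultimately have "((\<lambda>s. eta s / ((1 - 2 powr (1 - s)) / (s - 1))) \<longlongrightarrow> of_real (ln 2) / of_real (ln 2)) (at 1)"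
    by (intro tendsto_divide) auto
  thus ?thesis by (simp add: zeta_def mult.commute)
qed

text \<open>The numerator \<open>eta x\<close> is positive, and \<open>2 powr (1 - x) > 1\<close>
  makes the denominator negative.\<close>

lemma zeta_real_neg:
  fixes x :: real assumes "0 < x" "x < 1"
  shows "\<exists>y<0. zeta x = of_real y"
proof -
  have "(2::complex) powr (1 - of_real x) = of_real (2 powr (1 - x))"
    using powr_of_real[of 2 "1 - x"] by simp
  hence "zeta x = of_real (Re (eta x) / (1 - 2 powr (1 - x)))"
    using eta_real_sums(2)[of x] assms(1) by (simp add: zeta_def)
  moreover have "Re (eta x) / (1 - 2 powr (1 - x)) < 0"
    using eta_real_pos[of x] assms by (intro divide_pos_neg) auto
  ultimately show ?thesis by blast
qed

section \<open>Newton's identities\<close>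

text \<open>Truncating the entries at \<open>N\<close> leaves finitely many variables, as Newton's
  identities require; the full sum is recovered as \<open>N\<close> grows.\<close>

definition bounded_indices :: "nat \<Rightarrow> nat \<Rightarrow> nat list set" where
  "bounded_indices r N = {ms \<in> zeta_indices r. \<forall>m\<in>set ms. m \<le> N}"

lemma finite_bounded_indices: "finite (bounded_indices r N)"
proof (rule finite_subset)
  show "bounded_indices r N \<subseteq> {ms. set ms \<subseteq> {..N} \<and> length ms = r}"
    by (auto simp: bounded_indices_def zeta_indices_def)
qed (intro finite_lists_length_eq finite_atMost)

lemma bounded_indices_0: "bounded_indices 0 N = {[]}"
  by (auto simp: bounded_indices_def zeta_indices_def)

lemma bounded_indices_Suc_0: "bounded_indices (Suc r) 0 = {}"
proof -
  have False if "ms \<in> bounded_indices (Suc r) 0" for ms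
    using that by (cases ms) (auto simp: bounded_indices_def zeta_indices_def)
  thus ?thesis by blast
qed

lemma bounded_indices_Suc_Suc:
  "bounded_indices (Suc r) (Suc N) =
     bounded_indices (Suc r) N \<union> (\<lambda>ms. ms @ [Suc N]) ` bounded_indices r N"
proof (intro equalityI subsetI)
  fix ms assume ms: "ms \<in> bounded_indices (Suc r) (Suc N)"
  then obtain ks k where ks: "ms = ks @ [k]"
    by (cases ms rule: rev_cases) (auto simp: bounded_indices_def zeta_indices_def)
  show "ms \<in> bounded_indices (Suc r) N \<union> (\<lambda>ms. ms @ [Suc N]) ` bounded_indices r N"
  proof (cases "k = Suc N")
    case True
    have "ks \<in> bounded_indices r N"
      using ms True by (auto simp: ks bounded_indices_def zeta_indices_def sorted_wrt_append)
    thus ?thesis using ks True by blast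
  next
    case False
    have "ms \<in> bounded_indices (Suc r) N"
      using ms False by (auto simp: ks bounded_indices_def zeta_indices_def sorted_wrt_append)
    thus ?thesis by blast
  qed
next
  fix ms assume "ms \<in> bounded_indices (Suc r) N \<union> (\<lambda>ms. ms @ [Suc N]) ` bounded_indices r N"
  thus "ms \<in> bounded_indices (Suc r) (Suc N)"
    by (auto simp: bounded_indices_def zeta_indices_def sorted_wrt_append le_Suc_eq less_Suc_eq_le)
qed

text \<open>The elementary symmetric polynomial of degree \<open>r\<close> in
  \<open>x 1, ..., x N\<close>.\<close>

definition esym :: "(nat \<Rightarrow> 'a :: comm_ring_1) \<Rightarrow> nat \<Rightarrow> nat \<Rightarrow> 'a" where
  "esym x r N = (\<Sum>ms\<in>bounded_indices r N. prod_list (map x ms))"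

lemma esym_0 [simp]: "esym x 0 N = 1"
  by (simp add: esym_def bounded_indices_0)

lemma esym_Suc_0 [simp]: "esym x (Suc r) 0 = 0"
  by (simp add: esym_def bounded_indices_Suc_0)

lemma esym_Suc_Suc: "esym x (Suc r) (Suc N) = esym x (Suc r) N + x (Suc N) * esym x r N"
proof -
  have inj: "inj_on (\<lambda>ms. ms @ [Suc N]) (bounded_indices r N)"
    by (auto simp: inj_on_def)
  have "bounded_indices (Suc r) N \<inter> (\<lambda>ms. ms @ [Suc N]) ` bounded_indices r N = {}"
    by (auto simp: bounded_indices_def)
  hence "esym x (Suc r) (Suc N) = esym x (Suc r) N +
     (\<Sum>ms\<in>(\<lambda>ms. ms @ [Suc N]) ` bounded_indices r N. prod_list (map x ms))"
    unfolding esym_def bounded_indices_Suc_Suc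
    by (intro sum.union_disjoint) (auto simp: finite_bounded_indices)
  also have "(\<Sum>ms\<in>(\<lambda>ms. ms @ [Suc N]) ` bounded_indices r N. prod_list (map x ms)) =
     x (Suc N) * esym x r N"
    by (simp add: sum.reindex[OF inj] esym_def sum_distrib_left mult.commute)
  finally show ?thesis .
qed

text \<open>Newton's identities for all r at once, as the logarithmic derivative of the generating function.\<close>
lemma esym_fps_deriv:
  fixes x :: "nat \<Rightarrow> 'a :: comm_ring_1"
  shows "fps_deriv (Abs_fps (\<lambda>r. esym x r N)) =
    Abs_fps (\<lambda>j. (-1) ^ j * (\<Sum>m=1..N. x m ^ Suc j)) * Abs_fps (\<lambda>r. esym x r N)"
proof (induction N)
  case 0
  have "Abs_fps (\<lambda>r. esym x r 0) = 1"
    by (rule fps_ext) (case_tac n; simp)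
  moreover have "Abs_fps (\<lambda>j. (-1) ^ j * (\<Sum>m=1..0. x m ^ Suc j)) = 0"
    by (rule fps_ext) simp
  ultimately show ?case by simp
next
  case (Suc N)
  define E P where "E = Abs_fps (\<lambda>r. esym x r N)"
    and "P = Abs_fps (\<lambda>j. (-1) ^ j * (\<Sum>m=1..N. x m ^ Suc j))"
  define c where "c = x (Suc N)"
  \<comment> \<open>Passing to \<open>Suc N\<close> multiplies the generating function by
    \<open>1 + c X\<close>; \<open>Q\<close> is the logarithmic derivative
    \<open>c / (1 + c X)\<close> of this factor.\<close>
  define Q where "Q = Abs_fps (\<lambda>j. (-1) ^ j * c ^ Suc j)"
  have E: "Abs_fps (\<lambda>r. esym x r (Suc N)) = E + fps_X * (fps_const c * E)"
  proof (rule fps_ext)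
    fix n show "Abs_fps (\<lambda>r. esym x r (Suc N)) $ n = (E + fps_X * (fps_const c * E)) $ n"
      by (cases n) (auto simp: E_def c_def esym_Suc_Suc)
  qed
  have P: "Abs_fps (\<lambda>j. (-1) ^ j * (\<Sum>m=1..Suc N. x m ^ Suc j)) = P + Q"
    by (rule fps_ext) (simp add: P_def Q_def c_def algebra_simps)
  have Q: "Q + fps_X * (fps_const c * Q) = fps_const c"
  proof (rule fps_ext)
    fix n show "(Q + fps_X * (fps_const c * Q)) $ n = fps_const c $ n"
      by (cases n) (auto simp: Q_def)
  qed
  have IH: "fps_deriv E = P * E" using Suc.IH by (simp add: E_def P_def)
  have "fps_deriv (E + fps_X * (fps_const c * E)) = P * (E + fps_X * (fps_const c * E)) + fps_const c * E"
    by (simp add: IH algebra_simps)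
  also have "\<dots> = P * (E + fps_X * (fps_const c * E)) + (Q + fps_X * (fps_const c * Q)) * E"
    by (simp only: Q)
  also have "\<dots> = (P + Q) * (E + fps_X * (fps_const c * E))"
    by (simp add: algebra_simps)
  finally show ?case unfolding E P .
qed

lemma esym_newton:
  fixes x :: "nat \<Rightarrow> 'a :: comm_ring_1"
  shows "of_nat (Suc r) * esym x (Suc r) N =
    (\<Sum>j\<le>r. (-1) ^ j * (\<Sum>m=1..N. x m ^ Suc j) * esym x (r - j) N)"
  using arg_cong[OF esym_fps_deriv[of x N], of "\<lambda>F. F $ r"]
  by (simp add: fps_mult_nth atLeast0AtMost del: power_Suc)

text \<open>Every product in \<open>esym\<close> occurs in the expansion of the power. The bound
  stays finite as \<open>N\<close> grows when the \<open>x m\<close> are summable, which yields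
  absolute convergence of the multiple series.\<close>

lemma esym_nonneg_le:
  fixes x :: "nat \<Rightarrow> real"
  assumes "\<And>m. x m \<ge> 0"
  shows "esym x r N \<ge> 0 \<and> esym x r N \<le> (\<Sum>m=1..N. x m) ^ r"
proof (induction N arbitrary: r)
  case 0
  show ?case by (cases r) auto
next
  case (Suc N)
  show ?case
  proof (cases r)
    case (Suc q)
    define T where "T = (\<Sum>m=1..N. x m)"
    have T: "T \<ge> 0" unfolding T_def using assms by (intro sum_nonneg) auto
    have "esym x r (Suc N) \<le> T ^ Suc q + x (Suc N) * T ^ q"
      unfolding Suc esym_Suc_Suc T_def by (intro add_mono mult_left_mono Suc.IH[THEN conjunct2] assms)
    also have "\<dots> = (T + x (Suc N)) * T ^ q" by (simp add: algebra_simps)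
    also have "\<dots> \<le> (T + x (Suc N)) * (T + x (Suc N)) ^ q"
      using assms[of "Suc N"] T by (intro mult_left_mono power_mono) auto
    finally have "esym x r (Suc N) \<le> (\<Sum>m=1..Suc N. x m) ^ r" by (simp add: T_def Suc)
    thus ?thesis using Suc.IH[of q] Suc.IH[of "Suc q"] assms by (simp add: Suc esym_Suc_Suc)
  qed auto
qed

section \<open>Convergence of the multiple zeta series\<close>

lemma of_nat_prod_list_powr:
  "(of_nat (prod_list ms) :: complex) powr s = prod_list (map (\<lambda>m. of_nat m powr s) ms)"
  by (induction ms) (auto simp: powr_times_real)

text \<open>The truncated index sets exhaust all index tuples, so the unordered infinite sum can be
  computed as the limit of \<open>esym\<close> along \<open>N\<close>.\<close>

lemma filterlim_bounded_indices:
  "filterlim (bounded_indices r) (finite_subsets_at_top (zeta_indices r)) sequentially"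
  unfolding filterlim_finite_subsets_at_top
proof safe
  fix X assume X: "finite X" "X \<subseteq> zeta_indices r"
  \<comment> \<open>Inserting 0 keeps \<open>Max\<close> defined when the lists in \<open>X\<close>
    have no entries.\<close>
  have "X \<subseteq> bounded_indices r N" if N: "N \<ge> Max (insert 0 (\<Union>(set ` X)))" for N
  proof
    fix ms assume ms: "ms \<in> X"
    have "m \<le> N" if "m \<in> set ms" for m
      using X ms that by (intro order_trans[OF Max_ge N]) auto
    thus "ms \<in> bounded_indices r N" using ms X by (auto simp: bounded_indices_def)
  qed
  moreover have "bounded_indices r N \<subseteq> zeta_indices r" for N
    by (auto simp: bounded_indices_def)
  ultimately show "\<forall>\<^sub>F N in sequentially. finite (bounded_indices r N) \<and> X \<subseteq> bounded_indices r N \<and>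
      bounded_indices r N \<subseteq> zeta_indices r"
    unfolding eventually_sequentially using finite_bounded_indices by blast
qed

lemma multi_zeta_series_summable:
  assumes "Re s > 1"
  shows "(\<lambda>ms. of_nat (prod_list ms) powr (- s)) summable_on zeta_indices r"
proof (rule abs_summable_summable)
  define y where "y = (\<lambda>m. real m powr (- Re s))"
  have norm_eq: "norm (of_nat (prod_list ms) powr (- s)) = prod_list (map y ms)" for ms
    unfolding of_nat_prod_list_powr y_def
    by (induction ms) (auto simp: norm_mult norm_powr_real_powr)
  have summ: "summable y" unfolding y_def using assms by (simp add: summable_real_powr_iff)
  show "(\<lambda>ms. norm (of_nat (prod_list ms) powr (- s))) summable_on zeta_indices r"
  proof (rule nonneg_bounded_partial_sums_imp_summable_on)
    have "(\<Sum>ms\<in>X. norm (of_nat (prod_list ms) powr (- s))) \<le> (suminf y) ^ r"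
      if X: "finite X" "X \<subseteq> zeta_indices r" for X
    proof -
      from filterlim_bounded_indices[unfolded filterlim_finite_subsets_at_top, rule_format, of X r] X
      obtain N where N: "X \<subseteq> bounded_indices r N"
        by (auto simp: eventually_sequentially)
      have "(\<Sum>ms\<in>X. norm (of_nat (prod_list ms) powr (- s))) \<le>
         (\<Sum>ms\<in>bounded_indices r N. norm (of_nat (prod_list ms) powr (- s)))"
        using N by (intro sum_mono2 finite_bounded_indices) auto
      also have "\<dots> = esym y r N" by (simp only: norm_eq esym_def)
      also have "\<dots> \<le> (\<Sum>m=1..N. y m) ^ r"
        using esym_nonneg_le[of y r N] by (simp add: y_def)
      also have "\<dots> \<le> suminf y ^ r"
        by (intro power_mono sum_le_suminf[OF summ] sum_nonneg) (auto simp: y_def)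
      finally show ?thesis .
    qed
    thus "\<forall>\<^sub>F X in finite_subsets_at_top (zeta_indices r).
        (\<Sum>ms\<in>X. norm (of_nat (prod_list ms) powr (- s))) \<le> (suminf y) ^ r"
      by (auto intro!: eventually_finite_subsets_at_top_weakI)
  qed auto
qed

lemma esym_tendsto_multi_zeta_series:
  assumes "Re s > 1"
  shows "esym (\<lambda>m. of_nat m powr (- s)) r \<longlonglongrightarrow> multi_zeta_series r s"
proof -
  have "((\<lambda>ms. of_nat (prod_list ms) powr (- s)) has_sum multi_zeta_series r s) (zeta_indices r)"
    unfolding multi_zeta_series_def using multi_zeta_series_summable[OF assms] by (rule has_sum_infsum)
  hence "(sum (\<lambda>ms. of_nat (prod_list ms) powr (- s)) \<longlongrightarrow> multi_zeta_series r s)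
      (finite_subsets_at_top (zeta_indices r))"
    by (simp add: has_sum_def)
  from filterlim_compose[OF this filterlim_bounded_indices] show ?thesis
    by (simp add: esym_def[abs_def] of_nat_prod_list_powr)
qed

section \<open>Passage to the limit in Newton's identities\<close>

lemma power_sum_tendsto_zeta:
  assumes "Re s > 1"
  shows "(\<lambda>N. \<Sum>m=1..N. (of_nat m powr (- s)) ^ Suc j) \<longlonglongrightarrow> zeta (of_nat (Suc j) * s)"
proof -
  have "1 * Re s \<le> real (Suc j) * Re s" using assms by (intro mult_right_mono) auto
  moreover have "Re (of_nat (Suc j) * s) = real (Suc j) * Re s" by (simp del: of_nat_Suc)
  ultimately have "Re (of_nat (Suc j) * s) > 1" using assms by linarith
  from zeta_sums[OF this] have "(\<lambda>N. \<Sum>n<N. of_nat (Suc n) powr (- (of_nat (Suc j) * s))) \<longlonglongrightarrow> zeta (of_nat (Suc j) * s)"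
    by (simp add: sums_def)
  moreover have "of_nat (Suc n) powr (- (of_nat (Suc j) * s)) = (of_nat (Suc n) powr (- s)) ^ Suc j" for n
    by (simp add: powr_def exp_of_nat_mult[symmetric] algebra_simps del: of_nat_Suc power_Suc)
  moreover have "(\<Sum>n<N. (of_nat (Suc n) powr (- s)) ^ Suc j) = (\<Sum>m=1..N. (of_nat m powr (- s)) ^ Suc j)" for N
    by (rule sum.reindex_bij_witness[of _ "\<lambda>m. m - 1" Suc]) auto
  ultimately show ?thesis by (simp only:)
qed

text \<open>Newton's identity solved for the elementary symmetric function of highest degree, with
  the power sum of degree \<open>Suc j\<close> replaced by \<open>zeta (Suc j * s)\<close>. Junk
  values of \<open>zeta\<close> are inherited, so the continuation is this function only after
  \<open>remove_sings\<close>.\<close>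

fun newton_zeta :: "nat \<Rightarrow> complex \<Rightarrow> complex" where
  "newton_zeta 0 s = 1"
| "newton_zeta (Suc r) s =
     (\<Sum>j\<le>r. (-1) ^ j * zeta (of_nat (Suc j) * s) * newton_zeta (r - j) s) / of_nat (Suc r)"

lemma newton_zeta_eq_series:
  assumes "Re s > 1"
  shows "newton_zeta r s = multi_zeta_series r s"
proof (induction r rule: less_induct)
  case (less r)
  show ?case
  proof (cases r)
    case 0
    have "zeta_indices 0 = {[]}" by (auto simp: zeta_indices_def)
    thus ?thesis by (simp add: 0 multi_zeta_series_def)
  next
    case (Suc q)
    let ?x = "\<lambda>m. of_nat m powr (- s)"
    have "(\<lambda>N. \<Sum>j\<le>q. (-1) ^ j * (\<Sum>m=1..N. ?x m ^ Suc j) * esym ?x (q - j) N) \<longlonglongrightarrow>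
        (\<Sum>j\<le>q. (-1) ^ j * zeta (of_nat (Suc j) * s) * multi_zeta_series (q - j) s)"
      using assms by (intro tendsto_intros power_sum_tendsto_zeta esym_tendsto_multi_zeta_series)
    hence "(\<lambda>N. of_nat (Suc q) * esym ?x (Suc q) N) \<longlonglongrightarrow>
        (\<Sum>j\<le>q. (-1) ^ j * zeta (of_nat (Suc j) * s) * multi_zeta_series (q - j) s)"
      by (simp only: esym_newton)
    moreover have "(\<lambda>N. of_nat (Suc q) * esym ?x (Suc q) N) \<longlonglongrightarrow> of_nat (Suc q) * multi_zeta_series (Suc q) s"
      by (intro tendsto_intros esym_tendsto_multi_zeta_series assms)
    ultimately have "of_nat (Suc q) * multi_zeta_series (Suc q) s =
       (\<Sum>j\<le>q. (-1) ^ j * zeta (of_nat (Suc j) * s) * multi_zeta_series (q - j) s)"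
      by (rule LIMSEQ_unique[rotated])
    moreover have "multi_zeta_series (q - j) s = newton_zeta (q - j) s" for j
      using less.IH[of "q - j"] by (simp add: Suc)
    ultimately show ?thesis
      by (simp add: Suc field_simps del: of_nat_Suc)
  qed
qed

section \<open>Meromorphy and uniqueness of the continuation\<close>

lemma newton_zeta_meromorphic: "newton_zeta r meromorphic_on UNIV"
proof (induction r rule: less_induct)
  case (less r)
  show ?case
  proof (cases r)
    case (Suc q)
    have "(\<lambda>s. zeta (of_nat (Suc j) * s)) meromorphic_on UNIV" for j
      by (rule meromorphic_on_compose[OF zeta_meromorphic[of UNIV]]) (auto intro!: analytic_intros)
    thus ?thesis unfolding Suc newton_zeta.simps
      by (intro meromorphic_intros less.IH) (auto simp: Suc)
  qed (simp add: meromorphic_on_const)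
qed

lemma zeta_mult_analytic:
  assumes "real j * Re s \<noteq> 1"
  shows "(\<lambda>s. zeta (of_nat j * s)) analytic_on {s}"
proof -
  have "zeta analytic_on {of_nat j * s}" using assms by (intro zeta_analytic) simp
  moreover have "(\<lambda>s. of_nat j * s) analytic_on {s}" by (intro analytic_intros)
  ultimately have "zeta \<circ> (\<lambda>s. of_nat j * s) analytic_on {s}"
    by (intro analytic_on_compose_gen[of _ "{s}" _ "{of_nat j * s}"]) auto
  thus ?thesis by (simp add: o_def)
qed

text \<open>Only \<open>zeta (j * s)\<close> with \<open>j \<le> r\<close> enters, and it is
  analytic off the line \<open>Re s = 1 / j\<close>. The whole line is excluded, not just its real
  point, because all zeros of the denominator of \<open>zeta (j * s)\<close> lie on it.\<close>

lemma newton_zeta_analytic: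
  assumes "\<And>j. 1 \<le> j \<Longrightarrow> j \<le> r \<Longrightarrow> of_nat j * Re s \<noteq> 1"
  shows "newton_zeta r analytic_on {s}"
  using assms
proof (induction r rule: less_induct)
  case (less r)
  show ?case
  proof (cases r)
    case (Suc q)
    have "newton_zeta (q - j) analytic_on {s}" for j
      using less.prems by (intro less.IH) (auto simp: Suc)
    moreover have "(\<lambda>s. zeta (of_nat (Suc j) * s)) analytic_on {s}" if "j \<le> q" for j
      using less.prems[of "Suc j"] that by (intro zeta_mult_analytic) (auto simp: Suc)
    ultimately show ?thesis unfolding Suc newton_zeta.simps
      by (intro analytic_intros) (auto simp del: of_nat_Suc)
  qed auto
qed

text \<open>This justifies the definite description in \<open>multi_zeta\<close>. The difference
  with its singularities removed vanishes on \<open>U\<close>, hence everywhere, so \<open>f\<close>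
  and \<open>g\<close> agree on a punctured neighbourhood of each point.\<close>

lemma nicely_meromorphic_on_UNIV_eqI:
  assumes f: "f nicely_meromorphic_on UNIV" and g: "g nicely_meromorphic_on UNIV"
    and U: "open U" "U \<noteq> {}" and eq: "\<And>s. s \<in> U \<Longrightarrow> f s = g s"
  shows "f = g"
proof -
  define h where "h = remove_sings (\<lambda>s. f s - g s)"
  have mero: "(\<lambda>s. f s - g s) meromorphic_on UNIV"
    using f g by (simp add: meromorphic_on_diff nicely_meromorphic_on_def)
  hence h: "h nicely_meromorphic_on UNIV"
    unfolding h_def by (rule remove_sings_nicely_meromorphic)
  have h0: "h s = 0" if "s \<in> U" for s
  proof -
    have "\<forall>\<^sub>F w in at s. f w - g w = 0"
      using eventually_at_in_open'[OF U(1) that] by eventually_elim (simp add: eq)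
    hence "(\<lambda>w. f w - g w) \<midarrow>s\<rightarrow> 0" by (rule tendsto_eventually)
    thus ?thesis unfolding h_def by (rule remove_sings_eqI)
  qed
  hence "h constant_on U" by (auto simp: constant_on_def)
  hence "h constant_on UNIV"
    by (rule constant_on_extend_nicely_meromorphic_on[OF h]) (use U in auto)
  hence hz: "h s = 0" for s using h0 U(2) by (auto simp: constant_on_def)
  show ?thesis
  proof
    fix z
    have "isolated_singularity_at (\<lambda>s. f s - g s) z"
      using mero by (simp add: meromorphic_on_altdef)
    from eventually_remove_sings_eq_at[OF this] have ev: "\<forall>\<^sub>F w in at z. f w = g w"
      by eventually_elim (use hz in \<open>simp add: h_def\<close>)
    \<comment> \<open>Agreement on punctured neighbourhoods fixes the values too: a nicely
      meromorphic function equals its limit away from poles and 0 at a pole.\<close>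
    have "is_pole f z \<longleftrightarrow> is_pole g z" by (rule is_pole_cong[OF ev]) simp
    moreover have "f \<midarrow>z\<rightarrow> c \<longleftrightarrow> g \<midarrow>z\<rightarrow> c" for c by (rule filterlim_cong[OF refl refl ev])
    moreover have "(is_pole f z \<and> f z = 0) \<or> f \<midarrow>z\<rightarrow> f z" "(is_pole g z \<and> g z = 0) \<or> g \<midarrow>z\<rightarrow> g z"
      using f g by (simp_all add: nicely_meromorphic_on_def)
    moreover have "\<not> (is_pole g z \<and> g \<midarrow>z\<rightarrow> c)" for c
      using not_tendsto_and_filterlim_at_infinity[of "at z" g c] by (auto simp: is_pole_def)
    ultimately show "f z = g z" using LIM_unique[of g "f z" z "g z"] by metis
  qed
qed

lemma multi_zeta_eq: "multi_zeta r = remove_sings (newton_zeta r)"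
  unfolding multi_zeta_def
proof (rule the_equality)
  have nice: "remove_sings (newton_zeta r) nicely_meromorphic_on UNIV"
    by (intro remove_sings_nicely_meromorphic newton_zeta_meromorphic)
  have series: "remove_sings (newton_zeta r) s = multi_zeta_series r s" if s: "Re s > 1" for s
  proof -
    have "real j * Re s \<noteq> 1" if "1 \<le> j" for j
    proof -
      have "1 * Re s \<le> real j * Re s" using that s by (intro mult_right_mono) auto
      thus ?thesis using s by linarith
    qed
    hence "newton_zeta r analytic_on {s}" by (intro newton_zeta_analytic) auto
    thus ?thesis using newton_zeta_eq_series[OF s] by simp
  qed
  show "remove_sings (newton_zeta r) nicely_meromorphic_on UNIV \<and>
      (\<forall>s. Re s > 1 \<longrightarrow> remove_sings (newton_zeta r) s = multi_zeta_series r s)"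
    using nice series by blast
  fix f assume f: "f nicely_meromorphic_on UNIV \<and> (\<forall>s. Re s > 1 \<longrightarrow> f s = multi_zeta_series r s)"
  have "{s. Re s > 1} \<noteq> {}" by (auto intro!: exI[of _ 2])
  thus "f = remove_sings (newton_zeta r)"
    using f nice series
    by (intro nicely_meromorphic_on_UNIV_eqI[of _ _ "{s. Re s > 1}"] open_halfspace_Re_gt) auto
qed

lemma multi_zeta_eventually_eq: "\<forall>\<^sub>F s in at z. multi_zeta r s = newton_zeta r s"
proof -
  have "isolated_singularity_at (newton_zeta r) z"
    using newton_zeta_meromorphic[of r] by (simp add: meromorphic_on_altdef)
  from eventually_remove_sings_eq_at[OF this] show ?thesis
    by (simp add: multi_zeta_eq)
qed

lemma multi_zeta_analytic_eq: "newton_zeta r analytic_on {s} \<Longrightarrow> multi_zeta r s = newton_zeta r s"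
  by (simp add: multi_zeta_eq)

section \<open>Leading coefficients\<close>

text \<open>All multiples \<open>j * x\<close> with \<open>1 \<le> j \<le> r\<close> lie in (0, 1).
  With \<open>r = Suc q\<close>, a summand carries \<open>(-1) ^ j\<close> from Newton's identity,
  -1 from zeta and \<open>(-1) ^ (q - j)\<close> by induction; the product \<open>(-1) ^ r\<close>
  is independent of \<open>j\<close>, so nothing cancels.\<close>

lemma newton_zeta_real_sign:
  assumes "0 < x" "real r * x < 1"
  shows "\<exists>y>0. newton_zeta r (of_real x) = of_real ((-1) ^ r * y)"
  using assms(2)
proof (induction r rule: less_induct)
  case (less r)
  show ?case
  proof (cases r)
    case (Suc q)
    have le: "real j * x < 1" if "j \<le> r" for j
      using that assms(1) less.prems by (intro le_less_trans[OF mult_right_mono less.prems]) auto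
    have "\<forall>j\<in>{..q}. \<exists>y>0. newton_zeta (q - j) (of_real x) = of_real ((-1) ^ (q - j) * y)"
    proof
      fix j
      have "real (q - j) * x < 1" by (rule le) (simp add: Suc)
      thus "\<exists>y>0. newton_zeta (q - j) (of_real x) = of_real ((-1) ^ (q - j) * y)"
        by (intro less.IH) (simp_all add: Suc)
    qed
    then obtain Y where Y: "\<And>j. j \<le> q \<Longrightarrow> Y j > 0"
        "\<And>j. j \<le> q \<Longrightarrow> newton_zeta (q - j) (of_real x) = of_real ((-1) ^ (q - j) * Y j)"
      by (metis atMost_iff)
    have "\<exists>w>0. zeta (of_nat (Suc j) * of_real x) = of_real (- w)" if "j \<le> q" for j
    proof -
      have "real (Suc j) * x < 1" by (rule le) (use that in \<open>simp add: Suc\<close>)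
      moreover have "0 < real (Suc j) * x" using assms(1) by simp
      ultimately obtain y where "y < 0" "zeta (of_real (real (Suc j) * x)) = of_real y"
        using zeta_real_neg by blast
      thus ?thesis by (intro exI[of _ "- y"]) (simp del: of_nat_Suc)
    qed
    then obtain W where W: "\<And>j. j \<le> q \<Longrightarrow> W j > 0"
        "\<And>j. j \<le> q \<Longrightarrow> zeta (of_nat (Suc j) * of_real x) = of_real (- W j)"
      by metis
    have "(-1) ^ j * zeta (of_nat (Suc j) * of_real x) * newton_zeta (q - j) (of_real x) =
        of_real ((-1) ^ r * (W j * Y j))" if "j \<le> q" for j
    proof -
      have "(-1) ^ j * (- W j) * ((-1) ^ (q - j) * Y j) = (-1) ^ Suc (j + (q - j)) * (W j * Y j)"
        by (simp add: power_add)
      also have "Suc (j + (q - j)) = r" using that Suc by simp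
      finally have eq: "(-1) ^ j * (- W j) * ((-1) ^ (q - j) * Y j) = (-1) ^ r * (W j * Y j)" .
      have "(-1) ^ j * zeta (of_nat (Suc j) * of_real x) * newton_zeta (q - j) (of_real x) =
          of_real ((-1) ^ j * (- W j) * ((-1) ^ (q - j) * Y j))"
        unfolding W(2)[OF that] Y(2)[OF that] by simp
      thus ?thesis by (simp only: eq)
    qed
    hence "newton_zeta r (of_real x) = (\<Sum>j\<le>q. of_real ((-1) ^ r * (W j * Y j))) / of_nat (Suc q)"
      unfolding Suc newton_zeta.simps by (intro arg_cong2[of _ _ _ _ "(/)"] sum.cong) auto
    also have "\<dots> = of_real ((-1) ^ r * ((\<Sum>j\<le>q. W j * Y j) / real (Suc q)))"
      by (simp add: sum_distrib_left del: power_Suc of_nat_Suc)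
    finally have "newton_zeta r (of_real x) = of_real ((-1) ^ r * ((\<Sum>j\<le>q. W j * Y j) / real (Suc q)))" .
    moreover have "(\<Sum>j\<le>q. W j * Y j) / real (Suc q) > 0"
      using W(1) Y(1) by (intro divide_pos_pos sum_pos) auto
    ultimately show ?thesis by blast
  qed auto
qed

text \<open>The solution with value 1 at \<open>q = 0\<close> of the recursion in
  \<open>pole_coeff_Suc\<close>, which the summand \<open>j = k\<close> of Newton's identity imposes
  on the leading coefficients.\<close>

definition pole_coeff :: "nat \<Rightarrow> nat \<Rightarrow> complex" where
  "pole_coeff k q = (-1) ^ ((k - 1) * q) / (of_nat k ^ q * fact q)"

lemma pole_coeff_Suc:
  assumes "k \<ge> 1"
  shows "of_nat k * of_nat (Suc q) * pole_coeff k (Suc q) = (-1) ^ (k - 1) * pole_coeff k q"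
proof -
  have "(-1 :: complex) ^ ((k - 1) * Suc q) = (-1) ^ (k - 1) * (-1) ^ ((k - 1) * q)"
    by (simp add: power_add)
  thus ?thesis using assms by (simp add: pole_coeff_def field_simps del: of_nat_Suc)
qed

section \<open>Pole orders and limits at 1/k\<close>

lemma newton_zeta_recurrence:
  "of_nat (Suc r) * newton_zeta (Suc r) s =
     (\<Sum>j\<le>r. (-1) ^ j * zeta (of_nat (Suc j) * s) * newton_zeta (r - j) s)"
  by (simp del: of_nat_Suc)

lemma zeta_mult_tendsto_pole:
  assumes "k \<ge> 1"
  shows "((\<lambda>s. (of_nat k * s - 1) * zeta (of_nat k * s)) \<longlongrightarrow> 1) (at (1 / of_nat k))"
proof (rule filterlim_compose[OF zeta_residue])
  have "((\<lambda>s. of_nat k * s) \<longlongrightarrow> of_nat k * (1 / of_nat k)) (at (1 / of_nat k :: complex))"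
    by (intro tendsto_intros)
  moreover have "\<forall>\<^sub>F s in at (1 / of_nat k). of_nat k * s \<noteq> (1 :: complex)"
    using eventually_neq_at_within[of "1 / of_nat k"] by eventually_elim (use assms in \<open>auto simp: field_simps\<close>)
  ultimately show "filterlim (\<lambda>s. of_nat k * s) (at 1) (at (1 / of_nat k :: complex))"
    using assms by (auto simp: filterlim_at)
qed

lemma zeta_mult_tendsto:
  assumes "k \<ge> 1" "j \<noteq> k"
  shows "((\<lambda>s. zeta (of_nat j * s)) \<longlongrightarrow> zeta (of_nat j / of_nat k)) (at (1 / of_nat k))"
proof -
  have "(\<lambda>s. zeta (of_nat j * s)) analytic_on {1 / of_nat k}"
  proof (rule zeta_mult_analytic)
    have "Re (1 / of_nat k) = 1 / real k" by (metis Re_complex_of_real of_real_1 of_real_divide of_real_of_nat_eq)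
    thus "real j * Re (1 / of_nat k) \<noteq> 1" using assms by simp
  qed
  from analytic_at_imp_isCont[OF this] show ?thesis by (simp add: isCont_def)
qed

text \<open>\<open>r div k\<close> is the pole order at \<open>1 / k\<close>. Removing
  \<open>j\<close> from \<open>r\<close> keeps it while only the remainder is used up and lowers it
  otherwise; this decides which summands survive.\<close>

lemma div_diff_cases:
  fixes r k j :: nat
  assumes "k \<ge> 1" "1 \<le> j" "j \<le> r" "j \<noteq> k"
  shows "if j \<le> r mod k then (r - j) div k = r div k \<and> (r - j) mod k = r mod k - j
         else (r - j) div k < r div k"
proof (cases "j \<le> r mod k")
  case True
  define Q M where "Q = r div k" and "M = r mod k"
  have "M < k" "r = M + k * Q" using assms(1) by (simp_all add: Q_def M_def)
  hence "M - j < k" "r - j = (M - j) + k * Q" using True by (simp_all add: M_def[symmetric])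
  hence "(r - j) div k = Q" "(r - j) mod k = M - j" by simp_all
  thus ?thesis using True by (simp add: Q_def M_def)
next
  case False
  have "r - j < k * (r div k)" using False assms(3) mult_div_mod_eq[of k r] by linarith
  hence "(r - j) div k < r div k" using assms(1) by (simp add: div_less_iff_less_mult mult.commute)
  thus ?thesis using False by simp
qed

lemma newton_zeta_leading:
  assumes k: "k \<ge> 1"
  shows "((\<lambda>s. (of_nat k * s - 1) ^ (r div k) * newton_zeta r s) \<longlongrightarrow>
     pole_coeff k (r div k) * newton_zeta (r mod k) (1 / of_nat k)) (at (1 / of_nat k))"
proof (induction r rule: less_induct)
  case (less r)
  define z :: complex where "z = 1 / of_nat k"
  define u where "u = (\<lambda>s::complex. of_nat k * s - 1)"
  define q l where "q = r div k" and "l = r mod k"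
  define t where "t = (\<lambda>j s. (-1) ^ j * zeta (of_nat (Suc j) * s) * newton_zeta (r - Suc j) s)"
  \<comment> \<open>\<open>T j\<close> is the limit of the summand containing
    \<open>zeta (Suc j * s)\<close>. In the first branch the range of \<open>j\<close> forces
    \<open>k \<le> r\<close>, so \<open>q \<ge> 1\<close> and \<open>q - 1\<close> is a true
    predecessor.\<close>
  define T where "T = (\<lambda>j. if Suc j = k then (-1) ^ j * pole_coeff k (q - 1) * newton_zeta l z
      else if Suc j \<le> l then (-1) ^ j * zeta (of_nat (Suc j) * z) * (pole_coeff k q * newton_zeta (l - Suc j) z)
      else 0)"
  have l: "l < k" using k by (simp add: l_def)
  show ?case
  proof (cases r)
    case 0
    thus ?thesis by (simp add: pole_coeff_def)
  next
    case (Suc p)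
    have u: "(u \<longlongrightarrow> 0) (at z)"
    proof -
      have "(u \<longlongrightarrow> of_nat k * z - 1) (at z)" unfolding u_def by (intro tendsto_intros)
      thus ?thesis using k by (simp add: z_def)
    qed
    have IH: "((\<lambda>s. u s ^ (i div k) * newton_zeta i s) \<longlongrightarrow>
        pole_coeff k (i div k) * newton_zeta (i mod k) z) (at z)" if "i < r" for i
      using less.IH[OF that] by (simp add: u_def z_def)
    have tend: "((\<lambda>s. u s ^ q * t j s) \<longlongrightarrow> T j) (at z)" if j: "j \<le> p" for j
    proof (cases "Suc j = k")
      case True
      have rk: "r = (r - k) + k" using True j Suc by simp
      have q: "q = Suc ((r - k) div k)"
        unfolding q_def by (subst rk) (use k in simp)
      have lk: "(r - k) mod k = l"
        unfolding l_def by (subst (2) rk) simp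
      have "((\<lambda>s. (-1) ^ j * ((of_nat k * s - 1) * zeta (of_nat k * s)) * (u s ^ ((r - k) div k) * newton_zeta (r - k) s)) \<longlongrightarrow>
         (-1) ^ j * 1 * (pole_coeff k ((r - k) div k) * newton_zeta ((r - k) mod k) z)) (at z)"
        using zeta_mult_tendsto_pole[OF k] k rk Suc unfolding z_def[symmetric]
        by (intro tendsto_intros IH) auto
      moreover have "(-1) ^ j * ((of_nat k * s - 1) * zeta (of_nat k * s)) * (u s ^ ((r - k) div k) * newton_zeta (r - k) s)
          = u s ^ q * t j s" for s
        by (simp add: q t_def True u_def mult_ac del: of_nat_Suc)
      moreover have "(-1) ^ j * 1 * (pole_coeff k ((r - k) div k) * newton_zeta ((r - k) mod k) z) = T j"
        by (simp add: T_def True q lk)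
      ultimately show ?thesis by (simp only:)
    next
      case False
      note cs = div_diff_cases[of k "Suc j" r, OF k _ _ False]
      have zt: "((\<lambda>s. zeta (of_nat (Suc j) * s)) \<longlongrightarrow> zeta (of_nat (Suc j) * z)) (at z)"
        using zeta_mult_tendsto[OF k False] by (simp add: z_def)
      define i where "i = r - Suc j"
      have i: "i < r" using Suc by (simp add: i_def)
      \<comment> \<open>The surplus power of \<open>u\<close>: it is 0 if the pole order is kept,
        and otherwise positive, so that \<open>u\<close> tending to 0 kills the summand.\<close>
      define d where "d = q - i div k"
      have dq: "q = d + i div k" unfolding d_def q_def i_def by (simp add: div_le_mono)
      have "((\<lambda>s. (-1) ^ j * zeta (of_nat (Suc j) * s) * (u s ^ d * (u s ^ (i div k) * newton_zeta i s))) \<longlongrightarrow>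
         (-1) ^ j * zeta (of_nat (Suc j) * z) * (0 ^ d * (pole_coeff k (i div k) * newton_zeta (i mod k) z))) (at z)"
        by (intro tendsto_intros zt u IH i)
      moreover have "(-1) ^ j * zeta (of_nat (Suc j) * s) * (u s ^ d * (u s ^ (i div k) * newton_zeta i s))
          = u s ^ q * t j s" for s
        by (simp add: dq power_add t_def i_def mult_ac del: of_nat_Suc)
      moreover have "(-1) ^ j * zeta (of_nat (Suc j) * z) * (0 ^ d * (pole_coeff k (i div k) * newton_zeta (i mod k) z)) = T j"
      proof (cases "Suc j \<le> l")
        case True
        hence "i div k = q" "i mod k = l - Suc j"
          using cs j Suc by (auto simp: i_def q_def l_def)
        thus ?thesis using True False by (simp add: T_def d_def del: of_nat_Suc)
      next
        case ge: False
        hence "i div k < q" using cs j Suc by (auto simp: i_def q_def l_def)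
        hence "d > 0" by (simp add: d_def)
        thus ?thesis using False ge by (simp add: T_def)
      qed
      ultimately show ?thesis by simp
    qed
    have sum_T: "(\<Sum>j\<le>p. T j) = of_nat r * (pole_coeff k q * newton_zeta l z)"
    proof -
      define S where "S = (\<lambda>j. (-1) ^ j * zeta (of_nat (Suc j) * z) * (pole_coeff k q * newton_zeta (l - Suc j) z))"
      have lp: "l \<le> r" by (simp add: l_def)
      have "(\<Sum>j\<le>p. T j) = (\<Sum>j\<le>p. if j = k - 1 then (-1) ^ (k - 1) * pole_coeff k (q - 1) * newton_zeta l z else 0)
          + (\<Sum>j\<le>p. if j \<in> {..<l} then S j else 0)"
        unfolding sum.distrib[symmetric]
        by (intro sum.cong refl) (use k l in \<open>auto simp: T_def S_def\<close>)
      also have "(\<Sum>j\<le>p. if j \<in> {..<l} then S j else 0) = (\<Sum>j\<in>{..p} \<inter> {..<l}. S j)"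
        by (simp add: sum.inter_restrict)
      also have "{..p} \<inter> {..<l} = {..<l}" using lp Suc by auto
      \<comment> \<open>The summands that keep the pole order form Newton's identity for the
        remainder \<open>l\<close> at \<open>z\<close>.\<close>
      also have "(\<Sum>j<l. S j) = of_nat l * (pole_coeff k q * newton_zeta l z)"
      proof (cases l)
        case (Suc m)
        have "(\<Sum>j<l. S j) = (\<Sum>j\<le>m. pole_coeff k q * ((-1) ^ j * zeta (of_nat (Suc j) * z) * newton_zeta (m - j) z))"
          unfolding Suc S_def lessThan_Suc_atMost by (intro sum.cong) (auto simp: mult_ac simp del: of_nat_Suc)
        also have "\<dots> = pole_coeff k q * (of_nat l * newton_zeta l z)"
          unfolding Suc newton_zeta_recurrence sum_distrib_left ..
        finally show ?thesis by (simp add: mult_ac)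
      qed auto
      \<comment> \<open>For \<open>q > 0\<close> this is the recursion of \<open>pole_coeff\<close>;
        for \<open>q = 0\<close> the index \<open>k - 1\<close> lies beyond \<open>p\<close> and
        both sides are 0.\<close>
      also have "(\<Sum>j\<le>p. if j = k - 1 then (-1) ^ (k - 1) * pole_coeff k (q - 1) * newton_zeta l z else 0) =
          of_nat k * of_nat q * (pole_coeff k q * newton_zeta l z)"
      proof (cases q)
        case 0
        hence "r < k" using k by (simp add: q_def div_eq_0_iff)
        hence "\<not> k - 1 \<le> p" using Suc by simp
        thus ?thesis using 0 by simp
      next
        case (Suc m)
        hence "k \<le> r" by (cases "r < k") (auto simp: q_def)
        hence "k - 1 \<le> p" using \<open>r = Suc p\<close> by simp
        hence "(\<Sum>j\<le>p. if j = k - 1 then (-1) ^ (k - 1) * pole_coeff k (q - 1) * newton_zeta l z else 0) =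
            (-1) ^ (k - 1) * pole_coeff k m * newton_zeta l z"
          by (simp add: Suc)
        thus ?thesis by (simp only: pole_coeff_Suc[OF k, symmetric] Suc mult.assoc)
      qed
      also have "of_nat k * of_nat q * (pole_coeff k q * newton_zeta l z) + of_nat l * (pole_coeff k q * newton_zeta l z)
          = of_nat (k * q + l) * (pole_coeff k q * newton_zeta l z)"
        by (simp add: algebra_simps)
      also have "k * q + l = r" by (simp add: q_def l_def)
      finally show ?thesis .
    qed
    have "((\<lambda>s. (\<Sum>j\<le>p. u s ^ q * t j s) / of_nat r) \<longlongrightarrow> (\<Sum>j\<le>p. T j) / of_nat r) (at z)"
      using Suc by (intro tendsto_divide tendsto_sum tend tendsto_const) (auto simp del: of_nat_Suc)
    moreover have "(\<Sum>j\<le>p. u s ^ q * t j s) / of_nat r = u s ^ q * newton_zeta r s" for s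
      by (simp add: Suc t_def sum_distrib_left[symmetric] del: of_nat_Suc)
    moreover have "(\<Sum>j\<le>p. T j) / of_nat r = pole_coeff k q * newton_zeta l z"
      using Suc by (simp add: sum_T del: of_nat_Suc)
    ultimately show ?thesis by (simp add: u_def q_def l_def z_def)
  qed
qed

text \<open>For \<open>j \<le> l < k\<close> the points \<open>j / k\<close> stay below 1, so no
  pole is met and both functions agree at \<open>1 / k\<close> itself. The sign result makes the
  value real and non-zero, as \<open>is_leading_const\<close> demands of the constant.\<close>

lemma multi_zeta_inverse:
  assumes "k \<ge> 1" "l < k"
  shows "multi_zeta l (1 / of_nat k) = newton_zeta l (1 / of_nat k)"
    and "\<exists>y. y \<noteq> 0 \<and> multi_zeta l (1 / of_nat k) = of_real y"
proof -
  have z: "1 / of_nat k = complex_of_real (1 / real k)" by simp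
  show eq: "multi_zeta l (1 / of_nat k) = newton_zeta l (1 / of_nat k)"
    unfolding z by (intro multi_zeta_analytic_eq newton_zeta_analytic) (use assms in auto)
  obtain y where "y > 0" "newton_zeta l (1 / of_nat k) = of_real ((-1) ^ l * y)"
    using newton_zeta_real_sign[of "1 / real k" l] assms unfolding z by auto
  thus "\<exists>y. y \<noteq> 0 \<and> multi_zeta l (1 / of_nat k) = of_real y"
    unfolding eq by (intro exI[of _ "(-1) ^ l * y"]) auto
qed

text \<open>With \<open>r = k q + l\<close> this is the general formula; the claimed identities are
  the cases of quotient 1, of remainder 0, and of arbitrary quotient and remainder.\<close>

lemma leading_const:
  assumes k: "k \<ge> 1"
  shows "is_leading_const r k (leading_const r k)"
    and "complex_of_real (leading_const r k) =
      (-1) ^ ((k - 1) * (r div k)) / (of_nat k ^ (r div k) * fact (r div k)) * multi_zeta (r mod k) (1 / of_nat k)"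
proof -
  have l: "r mod k < k" using k by simp
  obtain y where y: "y \<noteq> 0" "multi_zeta (r mod k) (1 / of_nat k) = of_real y"
    using multi_zeta_inverse(2)[OF k l] by blast
  define c where "c = (-1) ^ ((k - 1) * (r div k)) / (real k ^ (r div k) * fact (r div k)) * y"
  have c0: "c \<noteq> 0" using k y(1) by (simp add: c_def)
  have c: "complex_of_real c = (-1) ^ ((k - 1) * (r div k)) / (of_nat k ^ (r div k) * fact (r div k))
       * multi_zeta (r mod k) (1 / of_nat k)"
    by (simp add: c_def y(2))
  \<comment> \<open>The limit only sees punctured neighbourhoods, and on a small one
    \<open>multi_zeta r\<close> and \<open>newton_zeta r\<close> coincide.\<close>
  have "((\<lambda>s. (of_nat k * s - 1) ^ (r div k) * multi_zeta r s) \<longlongrightarrow> complex_of_real c) (at (1 / of_nat k))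
    \<longleftrightarrow> ((\<lambda>s. (of_nat k * s - 1) ^ (r div k) * newton_zeta r s) \<longlongrightarrow> complex_of_real c) (at (1 / of_nat k))"
    by (intro filterlim_cong refl eventually_mono[OF multi_zeta_eventually_eq[of r]]) simp
  with newton_zeta_leading[OF k, of r]
  have lim: "((\<lambda>s. (of_nat k * s - 1) ^ (r div k) * multi_zeta r s) \<longlongrightarrow> complex_of_real c) (at (1 / of_nat k))"
    by (simp only: c multi_zeta_inverse(1)[OF k l] pole_coeff_def)
  have is_c: "is_leading_const r k c" using c0 lim by (simp add: is_leading_const_def)
  moreover have "c' = c" if "is_leading_const r k c'" for c'
    using LIM_unique[OF _ lim, of "complex_of_real c'"] that by (simp add: is_leading_const_def)
  ultimately have "leading_const r k = c"
    unfolding leading_const_def by (intro the_equality)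
  thus "is_leading_const r k (leading_const r k)" and "complex_of_real (leading_const r k) =
      (-1) ^ ((k - 1) * (r div k)) / (of_nat k ^ (r div k) * fact (r div k)) * multi_zeta (r mod k) (1 / of_nat k)"
    using is_c c by simp_all
qed

text \<open>The remainder is 0 and zeta_0 is 1. Taking \<open>q = 1\<close> gives the constant at
  \<open>k = r\<close>, and \<open>k = 1\<close> the one at \<open>s = 1\<close>.\<close>

lemma leading_const_dvd:
  assumes "k \<ge> 1"
  shows "leading_const (k * q) k = (-1) ^ ((k - 1) * q) / (real k ^ q * fact q)"
proof -
  have "multi_zeta 0 (1 / of_nat k) = 1"
    using multi_zeta_inverse(1)[of k 0] assms by simp
  hence "complex_of_real (leading_const (k * q) k) = of_real ((-1) ^ ((k - 1) * q) / (real k ^ q * fact q))"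
    using leading_const(2)[OF assms, of "k * q"] assms by simp
  thus ?thesis by (simp only: of_real_eq_iff)
qed

theorem theorem3:
  shows "(\<forall>r k. 1 \<le> k \<and> k \<le> r \<longrightarrow> is_leading_const r k (leading_const r k)) \<and>
    (\<forall>r\<ge>1. leading_const r r = (-1) ^ (r - 1) * (1 / real r)) \<and>
    (\<forall>r k. real r / 2 < real k \<and> k \<le> r - 1 \<longrightarrow>
       complex_of_real (leading_const r k) =
         (-1) ^ (k - 1) / of_nat k * multi_zeta (r - k) (1 / of_nat k)) \<and>
    (\<forall>r\<ge>1. leading_const r 1 = 1 / fact r) \<and>
    (\<forall>k\<ge>2. \<forall>r\<ge>1.
       leading_const (k * r) k = (-1) ^ ((k - 1) * r) / (real k ^ r * fact r) \<and>
       (\<forall>l. 1 \<le> l \<and> l \<le> k - 1 \<longrightarrow>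
          complex_of_real (leading_const (k * r + l) k) =
            (-1) ^ ((k - 1) * r) / (of_nat k ^ r * fact r) * multi_zeta l (1 / of_nat k)))"
proof (intro conjI allI impI)
  fix r k :: nat assume "1 \<le> k \<and> k \<le> r"
  thus "is_leading_const r k (leading_const r k)" by (simp add: leading_const(1))
next
  fix r :: nat assume "r \<ge> 1"
  thus "leading_const r r = (-1) ^ (r - 1) * (1 / real r)"
    using leading_const_dvd[of r 1] by simp
next
  fix r k :: nat assume "real r / 2 < real k \<and> k \<le> r - 1"
  hence rk: "r < 2 * k" "k < r" "k \<ge> 1" by auto
  have "r div k = 1" using rk by (intro div_nat_eqI) auto
  moreover have "r mod k = r - k" using rk by (simp add: le_mod_geq)
  ultimately show "complex_of_real (leading_const r k) =
         (-1) ^ (k - 1) / of_nat k * multi_zeta (r - k) (1 / of_nat k)"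
    using leading_const(2)[OF rk(3), of r] by simp
next
  fix r :: nat
  show "leading_const r 1 = 1 / fact r" using leading_const_dvd[of 1 r] by simp
next
  fix k r :: nat assume "k \<ge> 2"
  thus "leading_const (k * r) k = (-1) ^ ((k - 1) * r) / (real k ^ r * fact r)"
    by (intro leading_const_dvd) auto
next
  fix k r l :: nat assume k: "k \<ge> 2" and l: "1 \<le> l \<and> l \<le> k - 1"
  have "(k * r + l) div k = r" "(k * r + l) mod k = l" using k l by auto
  thus "complex_of_real (leading_const (k * r + l) k) =
            (-1) ^ ((k - 1) * r) / (of_nat k ^ r * fact r) * multi_zeta l (1 / of_nat k)"
    using leading_const(2)[of k "k * r + l"] k by simp
qed

end
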